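(* Let $X$ be a Baire space and let $Y$ be a topological space which has a dense set of $W$-points and such that the strong Choquet game $Ch(Y)$ is $\beta$-unfavorable. Then $X\times Y$ is a Baire space.
   Context: A topological space is a Baire space if every countable intersection of dense open subsets is dense. The strong Choquet game $Ch(Y)$: players $\beta$ and $\alpha$ alternate, $\beta$ first; at round $n$, $\beta$ chooses a point $x_n$ and an open set $V_n\ni x_n$ (with $V_n\subseteq U_{n-1}$ if $n\ge1$), then $\alpha$ chooses an open $U_n$ with $x_n\in U_n\subseteq V_n$; $\alpha$ wins if $\bigcap_n U_n\neq\emptyset$, otherwise $\beta$ wins. $Ch(Y)$ is $\beta$-unfavorable if $\beta$ has no winning strategy (a strategy being a function from finite sequences of opponent moves to legal moves, winning if every compatible play is won). The Gruenhage game $G(Y)$ at a point $y\in Y$: at round $n$, Player I chooses an open neighborhood $U_n$ of $y$ and Player II chooses a point $y_n\in U_n$; Player I wins if $(y_n)_n$ converges to $y$. A point $y$ is a $W$-point if Player I has a winning strategy in $G(Y)$ at $y$. *)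

theory Defs
  imports "HOL-Analysis.Analysis"
begin

definition Baire_space :: "'a::topological_space itself \<Rightarrow> bool" where
  "Baire_space _ \<longleftrightarrow>
     (\<forall>F :: 'a set set. countable F \<and> (\<forall>U\<in>F. open U \<and> closure U = UNIV)
        \<longrightarrow> closure (\<Inter>F) = UNIV)"

text \<open>Strong Choquet game. A strategy for beta maps the finite sequence of alpha's
  moves (open sets U_0,...,U_{n-1}) to beta's next move (x_n, V_n).\<close>
definition choquet_compatible :: "('a::topological_space set list \<Rightarrow> 'a \<times> 'a set) \<Rightarrow> 'a set list \<Rightarrow> bool" where
  "choquet_compatible \<sigma> us \<longleftrightarrow>
     (\<forall>i<length us. open (us ! i) \<and> fst (\<sigma> (take i us)) \<in> us ! i \<and> us ! i \<subseteq> snd (\<sigma> (take i us)))"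

definition choquet_beta_legal :: "('a::topological_space set list \<Rightarrow> 'a \<times> 'a set) \<Rightarrow> bool" where
  "choquet_beta_legal \<sigma> \<longleftrightarrow>
     (\<forall>us. choquet_compatible \<sigma> us \<longrightarrow>
        fst (\<sigma> us) \<in> snd (\<sigma> us) \<and> open (snd (\<sigma> us)) \<and>
        (us \<noteq> [] \<longrightarrow> snd (\<sigma> us) \<subseteq> last us))"

definition choquet_beta_winning :: "('a::topological_space set list \<Rightarrow> 'a \<times> 'a set) \<Rightarrow> bool" where
  "choquet_beta_winning \<sigma> \<longleftrightarrow>
     (\<forall>U :: nat \<Rightarrow> 'a set. (\<forall>n. choquet_compatible \<sigma> (map U [0..<n])) \<longrightarrow> (\<Inter>n. U n) = {})"

definition choquet_beta_unfavorable :: "'a::topological_space itself \<Rightarrow> bool" where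
  "choquet_beta_unfavorable _ \<longleftrightarrow>
     \<not> (\<exists>\<sigma> :: 'a set list \<Rightarrow> 'a \<times> 'a set. choquet_beta_legal \<sigma> \<and> choquet_beta_winning \<sigma>)"

text \<open>Gruenhage game at y: a strategy for Player I maps the finite sequence of
  Player II's points to an open neighbourhood of y.\<close>
definition W_point :: "'a::topological_space \<Rightarrow> bool" where
  "W_point y \<longleftrightarrow>
     (\<exists>\<tau> :: 'a list \<Rightarrow> 'a set.
        (\<forall>h. open (\<tau> h) \<and> y \<in> \<tau> h) \<and>
        (\<forall>ys :: nat \<Rightarrow> 'a. (\<forall>n. ys n \<in> \<tau> (map ys [0..<n])) \<longrightarrow> ys \<longlonglongrightarrow> y))"

end

theory Submission
  imports Defs
begin

text \<open>
  Given dense open sets \<open>O\<^sub>n\<close> and a box \<open>A \<times> B\<close>, one finds \<open>x \<in> A\<close> and a countable set \<open>D\<close> of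
  W-points meeting \<open>B\<close> such that every \<open>d \<in> D\<close> lies in the closure of \<open>D \<inter> {y. (x, y) \<in> O\<^sub>n}\<close>
  for every \<open>n\<close>. For a single \<open>d\<close> and \<open>n\<close> one lets Player I follow a winning strategy at \<open>d\<close>, while
  Player II answers with W-points \<open>p\<close> such that \<open>W \<times> {p} \<subseteq> O\<^sub>n\<close> for smaller and smaller open
  \<open>W \<subseteq> A\<close>; all these countably many games are interleaved, and since X is Baire, the choices can be
  made so that the sets \<open>W\<close> share a point \<open>x\<close>. In the strong Choquet game on Y, \<beta> can
  then always play a point of \<open>D\<close> and the part of the last set of \<alpha> inside \<open>{y. (x, y) \<in> O\<^sub>n}\<close>.
  This strategy is not winning, and a point surviving a play lost by \<beta> lies in every
  \<open>{y. (x, y) \<in> O\<^sub>n}\<close>.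
\<close>

lemma dense_iff_meets_open:
  "closure S = UNIV \<longleftrightarrow> (\<forall>G. open G \<longrightarrow> G \<noteq> {} \<longrightarrow> G \<inter> S \<noteq> {})"
proof
  assume "closure S = UNIV"
  then show "\<forall>G. open G \<longrightarrow> G \<noteq> {} \<longrightarrow> G \<inter> S \<noteq> {}"
    by (metis open_Int_closure_eq_empty inf_top_right)
next
  assume *: "\<forall>G. open G \<longrightarrow> G \<noteq> {} \<longrightarrow> G \<inter> S \<noteq> {}"
  have "open (- closure S)" "- closure S \<inter> S = {}"
    using closure_subset by auto
  with * show "closure S = UNIV" by blast
qed

text \<open>By Zorn's lemma: an index whose set misses all chosen ones could be added. Disjointness
  is between indices rather than sets, so a point lies in \<open>W s\<close> for at most one chosen
  \<open>s\<close>.\<close>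

lemma maximal_disjoint_subfamily:
  fixes W :: "'s \<Rightarrow> 'a set"
  obtains C where "C \<subseteq> S" "pairwise (\<lambda>s t. disjnt (W s) (W t)) C"
    "\<And>s. s \<in> S \<Longrightarrow> W s \<noteq> {} \<Longrightarrow> \<exists>t\<in>C. \<not> disjnt (W s) (W t)"
proof -
  define A where "A = {C. C \<subseteq> S \<and> pairwise (\<lambda>s t. disjnt (W s) (W t)) C}"
  have "\<exists>M\<in>A. \<forall>X\<in>A. M \<subseteq> X \<longrightarrow> X = M"
  proof (rule subset_Zorn')
    fix \<C> assume "subset.chain A \<C>"
    then have "\<C> \<subseteq> A" and tot: "\<And>X Y. X \<in> \<C> \<Longrightarrow> Y \<in> \<C> \<Longrightarrow> X \<subseteq> Y \<or> Y \<subseteq> X"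
      by (auto simp: subset_chain_def)
    then show "\<Union>\<C> \<in> A"
      unfolding A_def pairwise_def by (smt (verit) Union_iff mem_Collect_eq subset_iff)
  qed
  then obtain M where M: "M \<in> A" and max: "\<And>X. X \<in> A \<Longrightarrow> M \<subseteq> X \<Longrightarrow> X = M" by blast
  show thesis
  proof
    show "M \<subseteq> S" "pairwise (\<lambda>s t. disjnt (W s) (W t)) M"
      using M by (auto simp: A_def)
    fix s assume s: "s \<in> S" "W s \<noteq> {}"
    show "\<exists>t\<in>M. \<not> disjnt (W s) (W t)"
    proof (rule ccontr)
      assume neg: "\<not> ?thesis"
      then have "insert s M \<in> A"
        using M s by (auto simp: A_def pairwise_insert disjnt_sym)
      then have "s \<in> M" using max[of "insert s M"] by blast
      with neg s show False by (auto simp: disjnt_def)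
    qed
  qed
qed

text \<open>The half of Oxtoby's characterisation of Baire spaces by the Banach-Mazur game that is needed
  here. Disjointness of the sets on each level of the tree makes the branch through \<open>x\<close> unique,
  hence coherent.\<close>

lemma Baire_space_branch:
  fixes W :: "'s \<Rightarrow> 'a::topological_space set"
  assumes Baire: "Baire_space TYPE('a)"
    and s0: "P s0"
    and op: "\<And>s. P s \<Longrightarrow> open (W s) \<and> W s \<noteq> {}"
    and ext: "\<And>s G. P s \<Longrightarrow> open G \<Longrightarrow> G \<noteq> {} \<Longrightarrow> G \<subseteq> W s \<Longrightarrow> \<exists>t. P t \<and> R s t \<and> W t \<subseteq> G"
  obtains f x where "f 0 = s0" "\<And>k. P (f k)" "\<And>k. R (f k) (f (Suc k))" "\<And>k. x \<in> W (f k)"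
proof -
  let ?S = "\<lambda>s. {t. P t \<and> R s t \<and> W t \<subseteq> W s}"
  \<comment> \<open>Maximality makes the sets of \<open>F s\<close> dense in \<open>W s\<close>:
    \<open>ext\<close> puts a successor inside any nonempty open part of \<open>W s\<close>, and
    that successor must meet a member of \<open>F s\<close>.\<close>
  define good where "good s C \<longleftrightarrow> C \<subseteq> ?S s \<and> pairwise (\<lambda>s t. disjnt (W s) (W t)) C \<and>
      (\<forall>t\<in>?S s. W t \<noteq> {} \<longrightarrow> (\<exists>u\<in>C. \<not> disjnt (W t) (W u)))" for s C
  have "\<exists>C. good s C" for s
    unfolding good_def
    by (rule maximal_disjoint_subfamily[of "?S s" W]) (intro exI conjI ballI impI)
  then obtain F where "\<And>s. good s (F s)" by metis
  note good = this[unfolded good_def]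
  have F: "F s \<subseteq> ?S s" for s
    using good[of s] by (rule conjunct1)
  have Fdisj: "pairwise (\<lambda>s t. disjnt (W s) (W t)) (F s)" for s
    using good[of s] by (elim conjE)
  have Fmax: "\<exists>u\<in>F s. \<not> disjnt (W t) (W u)" if "t \<in> ?S s" "W t \<noteq> {}" for s t
    using good[of s, THEN conjunct2, THEN conjunct2, THEN bspec, OF that(1)] that(2) by (rule mp)
  define L where "L = rec_nat {s0} (\<lambda>_ X. \<Union>s\<in>X. F s)"
  have L0: "L 0 = {s0}" and LS: "\<And>k. L (Suc k) = (\<Union>s\<in>L k. F s)"
    by (simp_all add: L_def)
  have LP: "P s" if "s \<in> L k" for s k
    using that s0 F by (cases k) (auto simp: L0 LS)
  have Ldisj: "s = t" if "s \<in> L k" "t \<in> L k" "x \<in> W s" "x \<in> W t" for k s t x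
    using that
  proof (induction k arbitrary: s t)
    case 0
    then show ?case by (simp add: L0)
  next
    case (Suc k)
    then obtain s' t' where s': "s' \<in> L k" "s \<in> F s'" and t': "t' \<in> L k" "t \<in> F t'"
      by (auto simp: LS)
    then have "x \<in> W s'" "x \<in> W t'" using F Suc.prems by blast+
    then have "s' = t'" using Suc.IH s' t' by blast
    then show ?case
      using Fdisj[of s'] s' t' Suc.prems unfolding pairwise_def disjnt_def by blast
  qed
  have Ldense: "\<exists>t\<in>L k. G \<inter> W t \<noteq> {}" if "open G" "G \<noteq> {}" "G \<subseteq> W s0" for G k
  proof (induction k)
    case 0
    then show ?case using that by (auto simp: L0)
  next
    case (Suc k)
    then obtain s where s: "s \<in> L k" "G \<inter> W s \<noteq> {}" by blast
    have "open (G \<inter> W s)" using that op LP s by blast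
    then obtain t where t: "P t" "R s t" "W t \<subseteq> G \<inter> W s"
      using ext[of s "G \<inter> W s"] LP s by blast
    then obtain u where "u \<in> F s" "\<not> disjnt (W t) (W u)" using Fmax[of t s] op by blast
    then show ?case using s t unfolding LS disjnt_def by blast
  qed
  \<comment> \<open>The exterior of \<open>W s0\<close> is added because the Baire property concerns
    sets dense in the whole space; \<open>x\<close> is then taken in \<open>W s0\<close>.\<close>
  define E where "E k = (\<Union>s\<in>L k. W s) \<union> - closure (W s0)" for k
  have "open (E k)" for k
    unfolding E_def using LP op by (intro open_Un open_UN ballI open_Compl closed_closure) blast
  moreover have "closure (E k) = UNIV" for k
    unfolding dense_iff_meets_open
  proof (intro allI impI)
    fix G :: "'a set" assume G: "open G" "G \<noteq> {}"
    show "G \<inter> E k \<noteq> {}"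
    proof (cases "G \<inter> W s0 = {}")
      case True
      then have "G \<inter> closure (W s0) = {}" using G open_Int_closure_eq_empty by blast
      then show ?thesis using G by (auto simp: E_def)
    next
      case False
      then obtain t where "t \<in> L k" "G \<inter> W s0 \<inter> W t \<noteq> {}"
        using Ldense[of "G \<inter> W s0" k] G op s0 by blast
      then show ?thesis by (auto simp: E_def)
    qed
  qed
  ultimately have "closure (\<Inter>(range E)) = UNIV"
    using Baire unfolding Baire_space_def by (metis countableI_type countable_image rangeE)
  then have "W s0 \<inter> \<Inter>(range E) \<noteq> {}"
    using op[OF s0] by (simp add: dense_iff_meets_open)
  then obtain x where x: "x \<in> W s0" "\<And>k. x \<in> E k" by blast
  have xL: "\<exists>s\<in>L k. x \<in> W s" for k
    using x(2)[of k] x(1) closure_subset[of "W s0"] by (auto simp: E_def)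
  \<comment> \<open>A state of level \<open>Suc k\<close> around \<open>x\<close> has a parent in
    level \<open>k\<close> that also contains \<open>x\<close>; by \<open>Ldisj\<close> this parent
    is the state already chosen.\<close>
  have "\<exists>f. \<forall>k. ((f k \<in> L k \<and> x \<in> W (f k)) \<and> (k = 0 \<longrightarrow> f k = s0)) \<and> f (Suc k) \<in> F (f k)"
  proof (rule dependent_nat_choice)
    show "\<exists>s. (s \<in> L 0 \<and> x \<in> W s) \<and> (0 = (0::nat) \<longrightarrow> s = s0)" using x by (simp add: L0)
    fix s k assume s: "(s \<in> L k \<and> x \<in> W s) \<and> (k = 0 \<longrightarrow> s = s0)"
    obtain t where t: "t \<in> L (Suc k)" "x \<in> W t" using xL by blast
    then obtain s' where s': "s' \<in> L k" "t \<in> F s'" by (auto simp: LS)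
    then have "x \<in> W s'" using F t by blast
    then have "s' = s" using Ldisj s s' by blast
    then show "\<exists>t. ((t \<in> L (Suc k) \<and> x \<in> W t) \<and> (Suc k = 0 \<longrightarrow> t = s0)) \<and> t \<in> F s"
      using t s' by blast
  qed
  then obtain f where f: "\<And>k. f k \<in> L k \<and> x \<in> W (f k)" "f 0 = s0" "\<And>k. f (Suc k) \<in> F (f k)"
    by blast
  have "R (f k) (f (Suc k))" for k using f(3)[of k] F by blast
  then show thesis using that f LP by blast
qed

lemma choquet_beta_unfavorable_meets:
  fixes D V :: "'b::topological_space set" and Q :: "nat \<Rightarrow> 'b set"
  assumes unfav: "choquet_beta_unfavorable TYPE('b)"
    and Q: "\<And>n. open (Q n)" and V: "open V" "D \<inter> V \<noteq> {}"
    and D: "\<And>d n. d \<in> D \<Longrightarrow> d \<in> closure (D \<inter> Q n)"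
  shows "V \<inter> (\<Inter>n. Q n) \<noteq> {}"
proof -
  obtain y0 where y0: "y0 \<in> D" "y0 \<in> V" using V by blast
  define pick where "pick G = (SOME p. p \<in> D \<inter> G)" for G
  have pick: "pick G \<in> D \<inter> G" if "D \<inter> G \<noteq> {}" for G
    unfolding pick_def using that some_in_eq[of "D \<inter> G"] by blast
  \<comment> \<open>After \<open>n + 1\<close> moves of \<alpha>, \<beta> moves into
    \<open>Q n\<close>, so every \<open>Q n\<close> is used in an infinite play.\<close>
  define \<sigma> where "\<sigma> us = (if us = [] then (y0, V) else
    let G = last us \<inter> Q (length us - 1) in (pick G, G))" for us
  have \<sigma>snoc: "\<sigma> (us @ [u]) = (pick (u \<inter> Q (length us)), u \<inter> Q (length us))" for us u
    by (simp add: \<sigma>_def Let_def)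
  \<comment> \<open>Membership in \<open>D\<close> goes beyond legality but carries the induction:
    it lets the hypothesis on closures provide the next point of \<open>D\<close>.\<close>
  have legal: "fst (\<sigma> us) \<in> D \<and> fst (\<sigma> us) \<in> snd (\<sigma> us) \<and> open (snd (\<sigma> us)) \<and>
      (us \<noteq> [] \<longrightarrow> snd (\<sigma> us) \<subseteq> last us)"
    if "choquet_compatible \<sigma> us" for us
    using that
  proof (induction us rule: rev_induct)
    case Nil
    then show ?case using y0 V by (simp add: \<sigma>_def)
  next
    case (snoc u us)
    have "choquet_compatible \<sigma> us"
      unfolding choquet_compatible_def
    proof (intro allI impI)
      fix i assume "i < length us"
      then show "open (us ! i) \<and> fst (\<sigma> (take i us)) \<in> us ! i \<and> us ! i \<subseteq> snd (\<sigma> (take i us))"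
        using snoc.prems[unfolded choquet_compatible_def, rule_format, of i]
        by (simp add: nth_append)
    qed
    then have d: "fst (\<sigma> us) \<in> D" using snoc.IH by blast
    have u: "open u" "fst (\<sigma> us) \<in> u"
      using snoc.prems[unfolded choquet_compatible_def, rule_format, of "length us"] by simp_all
    have "u \<inter> (D \<inter> Q (length us)) \<noteq> {}"
      using D[OF d, of "length us"] u open_Int_closure_eq_empty[OF u(1)] by blast
    then show ?case
      using pick[of "u \<inter> Q (length us)"] u Q by (auto simp: \<sigma>snoc)
  qed
  then have "choquet_beta_legal \<sigma>" unfolding choquet_beta_legal_def by blast
  then obtain U where U: "\<And>n. choquet_compatible \<sigma> (map U [0..<n])" and "(\<Inter>n. U n) \<noteq> {}"
    using unfav unfolding choquet_beta_unfavorable_def choquet_beta_winning_def by blast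
  then obtain p where p: "\<And>n. p \<in> U n" by blast
  have sub: "U n \<subseteq> snd (\<sigma> (map U [0..<n]))" for n
    using U[of "Suc n", unfolded choquet_compatible_def, rule_format, of n]
    by (simp add: nth_append)
  have "p \<in> V" using sub[of 0] p by (auto simp: \<sigma>_def)
  moreover have "p \<in> Q n" for n
    using sub[of "Suc n"] p[of "Suc n"] by (auto simp: \<sigma>snoc)
  ultimately show ?thesis by blast
qed

text \<open>Step \<open>k\<close> with \<open>k = prod_encode (m, r)\<close> and \<open>m = prod_encode (i, n)\<close> plays round \<open>r\<close> of the
  Gruenhage game at \<open>d i\<close> with respect to \<open>O n\<close>, and the answer of Player II is \<open>d (Suc k)\<close>.
  Thus every game is played infinitely often and its centre \<open>d i\<close> is known in time.\<close>

lemma Baire_space_self_dense_sections: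
  fixes A :: "'a::topological_space set" and y0 :: "'b::topological_space"
    and Os :: "nat \<Rightarrow> ('a \<times> 'b) set"
  assumes Baire: "Baire_space TYPE('a)"
    and dense: "closure {y::'b. W_point y} = UNIV"
    and Os: "\<And>n. open (Os n)" "\<And>n. closure (Os n) = UNIV"
    and A: "open A" "A \<noteq> {}" and y0: "W_point y0"
  obtains x D where "x \<in> A" "y0 \<in> D"
    "\<And>d n. d \<in> D \<Longrightarrow> d \<in> closure (D \<inter> {y. (x, y) \<in> Os n})"
proof -
  have "\<exists>\<tau>. W_point y \<longrightarrow> (\<forall>h. open (\<tau> h) \<and> y \<in> \<tau> h) \<and>
      (\<forall>ys. (\<forall>n. ys n \<in> \<tau> (map ys [0..<n])) \<longrightarrow> ys \<longlonglongrightarrow> y)" for y :: 'b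
    unfolding W_point_def by blast
  then obtain \<tau> :: "'b \<Rightarrow> 'b list \<Rightarrow> 'b set"
    where \<tau>: "\<And>y h. W_point y \<Longrightarrow> open (\<tau> y h) \<and> y \<in> \<tau> y h"
    and \<tau>win: "\<And>y ys. W_point y \<Longrightarrow> (\<And>n. ys n \<in> \<tau> y (map ys [0..<n])) \<Longrightarrow> ys \<longlonglongrightarrow> y"
    by metis
  define nbhd where "nbhd d k = (case prod_decode k of (m, r) \<Rightarrow>
    \<tau> (d (fst (prod_decode m))) (map (\<lambda>j. d (Suc (prod_encode (m, j)))) [0..<r]))"
    for d :: "nat \<Rightarrow> 'b" and k
  define target where "target k = Os (snd (prod_decode (fst (prod_decode k))))" for k
  \<comment> \<open>In a state \<open>(k, d, W)\<close> only \<open>d 0\<close>, ...,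
    \<open>d k\<close> are settled; later entries hold the default \<open>y0\<close>, itself a
    W-point. \<open>W\<close> confines the future \<open>x\<close>.\<close>
  define P where "P s = (case s of (k, d, W) \<Rightarrow> open W \<and> W \<noteq> {} \<and> (\<forall>j. W_point (d j)))"
    for s :: "nat \<times> (nat \<Rightarrow> 'b) \<times> 'a set"
  define R where "R s t = (case s of (k, d, W) \<Rightarrow> case t of (k', d', W') \<Rightarrow>
      k' = Suc k \<and> (\<exists>p. d' = d(Suc k := p) \<and> p \<in> nbhd d k \<and> W' \<times> {p} \<subseteq> target k))"
    for s t :: "nat \<times> (nat \<Rightarrow> 'b) \<times> 'a set"
  define s0 where "s0 = (0::nat, (\<lambda>_::nat. y0), A)"
  have ext: "\<exists>t. P t \<and> R s t \<and> snd (snd t) \<subseteq> G"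
    if s: "P s" and G: "open G" "G \<noteq> {}" "G \<subseteq> snd (snd s)" for s G
  proof -
    obtain k d W where skd: "s = (k, d, W)" by (cases s)
    have d: "W_point (d j)" for j using s by (auto simp: P_def skd)
    have N: "open (nbhd d k)" "nbhd d k \<noteq> {}"
      using \<tau>[OF d] by (auto simp: nbhd_def split: prod.split)
    have "(G \<times> nbhd d k) \<inter> target k \<noteq> {}"
      using Os(2) G N unfolding target_def dense_iff_meets_open
      by (simp add: open_Times)
    then obtain a b where ab: "(a, b) \<in> (G \<times> nbhd d k) \<inter> target k" by auto
    have "open ((G \<times> nbhd d k) \<inter> target k)"
      using G N Os by (auto simp: target_def intro!: open_Int open_Times)
    then obtain G' H where GH: "open G'" "open H" "a \<in> G'" "b \<in> H"
      "G' \<times> H \<subseteq> (G \<times> nbhd d k) \<inter> target k"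
      using ab by (elim open_prod_elim) auto
    \<comment> \<open>The answer has to be a W-point, since it becomes the centre of further
      games.\<close>
    then obtain p where p: "p \<in> H" "W_point p"
      using dense unfolding dense_iff_meets_open by blast
    have "P (Suc k, d(Suc k := p), G')"
      using GH p d by (auto simp: P_def)
    moreover have "R s (Suc k, d(Suc k := p), G')"
      using GH p by (auto simp: R_def skd)
    moreover have "G' \<subseteq> G" using GH by auto
    ultimately show ?thesis by (metis snd_conv)
  qed
  have "P s0" using A y0 by (simp add: P_def s0_def)
  then obtain f x where f0: "f 0 = s0" and fP: "\<And>k. P (f k)"
    and fR: "\<And>k. R (f k) (f (Suc k))" and xf: "\<And>k. x \<in> snd (snd (f k))"
    by (rule Baire_space_branch[OF Baire, of P s0 "\<lambda>s. snd (snd s)" R])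
      (use ext in \<open>auto simp: P_def\<close>)
  define e where "e k = fst (snd (f k))" for k
  \<comment> \<open>Entry \<open>k\<close> is final from state \<open>k\<close> on, so the diagonal
    is the limit of the sequences \<open>e k\<close>.\<close>
  define d where "d k = e k k" for k
  have fst_f: "fst (f k) = k" for k
  proof (induction k)
    case (Suc k)
    then show ?case using fR[of k] by (auto simp: R_def split: prod.splits)
  qed (simp add: f0 s0_def)
  have step: "\<exists>p. e (Suc k) = (e k)(Suc k := p) \<and> p \<in> nbhd (e k) k \<and> (x, p) \<in> target k" for k
    using fR[of k] fst_f[of k] xf[of "Suc k"] by (auto simp: R_def e_def split: prod.splits)
  have ed: "e k j = d j" if "j \<le> k" for j k
    using that
  proof (induction k)
    case (Suc k)
    then show ?case using step[of k] by (cases "j = Suc k") (auto simp: d_def)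
  qed (simp add: d_def)
  have Wd: "W_point (d k)" for k
    using fP[of k] by (auto simp: P_def d_def e_def split: prod.splits)
  have play: "d (Suc k) \<in> nbhd (e k) k" "(x, d (Suc k)) \<in> target k" for k
    using step[of k] by (auto simp: d_def)
  have round: "d (Suc (prod_encode (prod_encode (i, n), r))) \<in>
      \<tau> (d i) (map (\<lambda>j. d (Suc (prod_encode (prod_encode (i, n), j)))) [0..<r])" for i n r
  proof -
    let ?m = "prod_encode (i, n)"
    let ?k = "prod_encode (?m, r)"
    \<comment> \<open>Pairing dominates its components and grows strictly in the second one, so the
      centre and all earlier answers have index at most \<open>?k\<close>, where \<open>e ?k\<close>
      agrees with \<open>d\<close>.\<close>
    have "i \<le> ?k" using le_prod_encode_1[of i n] le_prod_encode_1[of ?m r] by linarith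
    moreover have "Suc (prod_encode (?m, j)) \<le> ?k" if "j < r" for j
      using that by (induction r) (auto simp: prod_encode_def less_Suc_eq)
    ultimately have "nbhd (e ?k) ?k = \<tau> (d i) (map (\<lambda>j. d (Suc (prod_encode (?m, j)))) [0..<r])"
      by (auto simp: nbhd_def ed intro!: arg_cong[where f = "\<tau> (d i)"])
    then show ?thesis using play(1)[of ?k] by simp
  qed
  have "d i \<in> closure (range d \<inter> {y. (x, y) \<in> Os n})" for i n
  proof -
    let ?ys = "\<lambda>r. d (Suc (prod_encode (prod_encode (i, n), r)))"
    have "?ys \<longlonglongrightarrow> d i" using \<tau>win[OF Wd round] .
    moreover have "?ys r \<in> range d \<inter> {y. (x, y) \<in> Os n}" for r
      using play(2)[of "prod_encode (prod_encode (i, n), r)"] by (simp add: target_def)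
    ultimately show ?thesis
      by (intro Lim_in_closed_set[of _ ?ys sequentially])
        (auto intro!: always_eventually subsetD[OF closure_subset])
  qed
  moreover have "x \<in> A" using xf[of 0] by (simp add: f0 s0_def)
  moreover have "y0 \<in> range d"
    by (rule range_eqI[of _ _ 0]) (simp add: d_def e_def f0 s0_def)
  ultimately show thesis using that[of x "range d"] by blast
qed

theorem theorem3p2:
  assumes "Baire_space TYPE('a::topological_space)"
    and "closure {y::'b::topological_space. W_point y} = UNIV"
    and "choquet_beta_unfavorable TYPE('b)"
  shows "Baire_space TYPE('a \<times> 'b)"
  unfolding Baire_space_def
proof (intro allI impI)
  fix F :: "('a \<times> 'b) set set"
  assume F: "countable F \<and> (\<forall>U\<in>F. open U \<and> closure U = UNIV)"
  \<comment> \<open>Adding \<open>UNIV\<close> leaves the intersection unchanged and allows an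
    enumeration even when \<open>F\<close> is empty.\<close>
  define Os where "Os = from_nat_into (insert UNIV F)"
  have range: "range Os = insert UNIV F"
    unfolding Os_def using F by (intro range_from_nat_into) auto
  then have Os: "open (Os n)" "closure (Os n) = UNIV" for n
    using F by (metis closure_UNIV insert_iff open_UNIV rangeI)+
  show "closure (\<Inter>F) = UNIV"
    unfolding dense_iff_meets_open
  proof (intro allI impI)
    fix G :: "('a \<times> 'b) set" assume G: "open G" "G \<noteq> {}"
    then obtain a b where "(a, b) \<in> G" by auto
    with G obtain A B where AB: "open A" "open B" "a \<in> A" "b \<in> B" "A \<times> B \<subseteq> G"
      by (elim open_prod_elim) auto
    then obtain y0 where y0: "y0 \<in> B" "W_point y0"
      using assms(2) unfolding dense_iff_meets_open by blast
    obtain x D where x: "x \<in> A" and D: "y0 \<in> D"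
      "\<And>d n. d \<in> D \<Longrightarrow> d \<in> closure (D \<inter> {y. (x, y) \<in> Os n})"
      by (rule Baire_space_self_dense_sections[where Os = Os, OF assms(1,2) Os AB(1) _ y0(2)])
        (use AB(3) in auto)
    have "open {y. (x, y) \<in> Os n}" for n
      using open_vimage[OF Os(1)[of n], of "Pair x"]
      by (simp add: vimage_def continuous_on_Pair)
    then have "B \<inter> (\<Inter>n. {y. (x, y) \<in> Os n}) \<noteq> {}"
      using D y0 AB by (intro choquet_beta_unfavorable_meets[OF assms(3)]) auto
    then obtain y where "y \<in> B" "\<And>n. (x, y) \<in> Os n" by blast
    then have "(x, y) \<in> G \<inter> \<Inter>F" using range x AB by blast
    then show "G \<inter> \<Inter>F \<noteq> {}" by blast
  qed
qed

end
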